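(* Let $k$ be an algebraically closed field of characteristic zero, let $1\le p\le n$ be integers, and let $Z\subset\mathbb{P}^n$ be a closed subscheme with saturated homogeneous ideal $I_Z\subset R=k[x_0,\dots,x_n]$. Fix a minimal graded free resolution $$0\longrightarrow F_n\stackrel{\phi_n}{\longrightarrow}F_{n-1}\stackrel{\phi_{n-1}}{\longrightarrow}\cdots\longrightarrow F_0\stackrel{\phi_0}{\longrightarrow}I_Z\longrightarrow 0$$ with the $\phi_i$ written as matrices with respect to homogeneous bases, and identify $\operatorname{Tor}^R_p(I_Z,k)$ with $F_p\otimes_Rk$. Then the $k$-linear map $\xi_p\colon\operatorname{Tor}^R_p(I_Z,k)\to\mathcal{A}^p(Z)$ defined by $$\xi_p(t)=\phi_0\cdot\delta\Big(\phi_1\cdot\delta\big(\phi_2\cdots\delta(\phi_{p-1}\cdot\delta(\phi_p))\cdots\big)\Big)\cdot t$$ (alternating the operator $\delta$ and multiplication by the matrices $\phi_i$) is injective, and its image meets the submodule $I_Z\cdot\iota_{\mathrm{rad}}(\Omega^{p+1}_R)\subset\mathcal{A}^p(Z)$ only in $0$.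
   Context: Let $R=k[x_0,\dots,x_n]$ with its standard grading, $V^*=\langle dx_0,\dots,dx_n\rangle$, and let $\Omega^q_R=R\otimes_k\bigwedge^qV^*$ be the free $R$-module of polynomial differential $q$-forms, with $\Omega^0_R=R$. Let $\mathrm{rad}=\sum_ix_i\frac{\partial}{\partial x_i}$ be the radial vector field and let $\iota_{\mathrm{rad}}\colon\Omega^q_R\to\Omega^{q-1}_R$ be the $R$-linear contraction with $\mathrm{rad}$. Let $\mathscr{I}_Z$ be the ideal sheaf of $Z$ and $I_Z=\bigoplus_jH^0(\mathbb{P}^n,\mathscr{I}_Z(j))$. Define $\mathcal{A}^p(Z)=\bigoplus_{d\ge 0}H^0(\mathbb{P}^n,\Omega^p_{\mathbb{P}^n}(d+p+1)\otimes\mathscr{I}_Z)$. Its degree-$d$ part is identified, via the Euler sequence, with the space of $p$-forms $\omega\in\Omega^p_R$ with $\iota_{\mathrm{rad}}\omega=0$ all of whose coefficients lie in $(I_Z)_{d+1}$. The submodule $I_Z\cdot\iota_{\mathrm{rad}}(\Omega^{p+1}_R)$ consists of all finite sums $\sum_iF_i\,\iota_{\mathrm{rad}}\eta_i$ with $F_i\in I_Z$ and $\eta_i\in\Omega^{p+1}_R$. The operator $\delta\colon\Omega^q_R\to\Omega^{q+1}_R$ is the $k$-linear map given on a homogeneous form $\omega$ by $\delta\omega=\frac{d\omega}{\deg\omega}$, where $\deg\omega$ is the total degree with $\deg x_i=\deg dx_i=1$ (and $\delta$ is $0$ on constants). It is applied entrywise to matrices of forms, $\delta(g_{ij})=(\delta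 g_{ij})$. The symbol $\cdot$ denotes matrix multiplication, using the multiplication of polynomials with forms. Here $\phi_0$ is the row vector of minimal generators of $I_Z$. Since the resolution is minimal, with $F_p=\bigoplus_jR(-j)^{\beta_{p,j}}$, we have $\operatorname{Tor}^R_p(I_Z,k)\cong F_p\otimes_Rk=\bigoplus_jk^{\beta_{p,j}}$. An element $t$ is regarded as a column vector of constants. For example, $\xi_1(t)=\phi_0\cdot\delta(\phi_1)\cdot t$ and $\xi_2(t)=\phi_0\cdot\delta(\phi_1\cdot\delta\phi_2)\cdot t$. *)

theory Defs
  imports
    "HOL-Library.Poly_Mapping"
    "HOL-Library.Cardinality"
    "HOL-Computational_Algebra.Polynomial"
    "Jordan_Normal_Form.Matrix_Kernel"
begin

section \<open>The polynomial ring\<close>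

text \<open>
  The variables are indexed by a finite linearly ordered type \<open>'v\<close> with \<open>CARD('v) = n + 1\<close>, so the
  type \<open>('v, 'k) mpoly\<close> is the whole ring \<open>R = k[x\<^sub>0, \<dots>, x\<^sub>n]\<close>: a polynomial is a finitely supported
  function from exponent vectors to coefficients.
\<close>

type_synonym ('v, 'k) mpoly = "('v \<Rightarrow>\<^sub>0 nat) \<Rightarrow>\<^sub>0 'k"

definition const_poly :: "'k::zero \<Rightarrow> ('v, 'k) mpoly" where
  "const_poly c = Poly_Mapping.single 0 c"

definition var :: "'v \<Rightarrow> ('v, 'k::zero_neq_one) mpoly" where
  "var i = Poly_Mapping.single (Poly_Mapping.single i 1) 1"

definition mon_degree :: "('v::finite \<Rightarrow>\<^sub>0 nat) \<Rightarrow> nat" where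
  "mon_degree m = (\<Sum>i\<in>UNIV. Poly_Mapping.lookup m i)"

text \<open>The degree is an integer, so that a polynomial homogeneous of negative degree is \<open>0\<close>.\<close>

definition homogeneous :: "int \<Rightarrow> ('v::finite, 'k::zero) mpoly \<Rightarrow> bool" where
  "homogeneous d f \<longleftrightarrow> (\<forall>m\<in>Poly_Mapping.keys f. int (mon_degree m) = d)"

definition poly_component :: "nat \<Rightarrow> ('v::finite, 'k::comm_monoid_add) mpoly \<Rightarrow> ('v, 'k) mpoly" where
  "poly_component d f =
     (\<Sum>m | m \<in> Poly_Mapping.keys f \<and> mon_degree m = d.
        Poly_Mapping.single m (Poly_Mapping.lookup f m))"

definition partial :: "'v \<Rightarrow> ('v, 'k::comm_semiring_1) mpoly \<Rightarrow> ('v, 'k) mpoly" where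
  "partial i f =
     (\<Sum>m\<in>Poly_Mapping.keys f.
        Poly_Mapping.single (m - Poly_Mapping.single i 1)
          (of_nat (Poly_Mapping.lookup m i) * Poly_Mapping.lookup f m))"


section \<open>Saturated homogeneous ideals\<close>

definition is_ideal :: "'a::comm_ring_1 set \<Rightarrow> bool" where
  "is_ideal I \<longleftrightarrow> module.subspace (*) I"

definition irrelevant_ideal :: "('v, 'k::comm_ring_1) mpoly set" where
  "irrelevant_ideal = module.span (*) (range var)"

definition homogeneous_ideal :: "('v::finite, 'k::comm_ring_1) mpoly set \<Rightarrow> bool" where
  "homogeneous_ideal I \<longleftrightarrow> is_ideal I \<and> (\<forall>f\<in>I. \<forall>d. poly_component d f \<in> I)"

text \<open>
  The saturation consists of the \<open>f\<close> such that every variable has a power multiplying \<open>f\<close> into \<open>I\<close>.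
  Closed subschemes of \<open>\<bbbP>\<^sup>n\<close> correspond bijectively to saturated homogeneous ideals of \<open>R\<close>, via
  \<open>Z \<mapsto> I\<^sub>Z\<close>; a subscheme is represented by its ideal. The zero ideal (\<open>Z = \<bbbP>\<^sup>n\<close>) and the unit
  ideal (\<open>Z = \<emptyset>\<close>) are included.
\<close>

definition saturation :: "('v, 'k::comm_ring_1) mpoly set \<Rightarrow> ('v, 'k) mpoly set" where
  "saturation I = {f. \<forall>i. \<exists>N. var i ^ N * f \<in> I}"

definition saturated_homogeneous_ideal :: "('v::finite, 'k::comm_ring_1) mpoly set \<Rightarrow> bool" where
  "saturated_homogeneous_ideal I \<longleftrightarrow> homogeneous_ideal I \<and> saturation I = I"


section \<open>Polynomial differential forms\<close>

text \<open>
  The free \<open>R\<close>-module \<open>\<Omega>\<^sub>R = R \<otimes> \<And>V\<^sup>*\<close> has the basis \<open>dx\<^sub>S = dx\<^bsub>i1\<^esub> \<and> \<dots> \<and> dx\<^bsub>iq\<^esub>\<close>, one for each set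
  \<open>S = {i1 < \<dots> < iq}\<close> of variables; a form is the finitely supported function of its coefficients,
  and \<open>Poly_Mapping.single S f\<close> is \<open>f dx\<^sub>S\<close>.
\<close>

type_synonym ('v, 'k) form = "'v set \<Rightarrow>\<^sub>0 ('v, 'k) mpoly"

definition forms :: "nat \<Rightarrow> ('v, 'k::zero) form set" where
  "forms q = {\<omega>. \<forall>S\<in>Poly_Mapping.keys \<omega>. card S = q}"

definition form_scale :: "('v, 'k::comm_semiring_1) mpoly \<Rightarrow> ('v, 'k) form \<Rightarrow> ('v, 'k) form"
  (infixr \<open>\<bullet>\<^sub>f\<close> 75) where
  "f \<bullet>\<^sub>f \<omega> = Poly_Mapping.map (\<lambda>g. f * g) \<omega>"

text \<open>
  \<open>wedge_sign i S\<close> is the sign in \<open>dx\<^sub>i \<and> dx\<^sub>S = \<plusminus> dx\<^bsub>S \<union> {i}\<^esub>\<close> for \<open>i \<notin> S\<close>, and equally the sign with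
  which \<open>dx\<^bsub>S - {i}\<^esub>\<close> occurs in the contraction of \<open>dx\<^sub>S\<close> with \<open>\<partial>/\<partial>x\<^sub>i\<close> for \<open>i \<in> S\<close>.
\<close>

definition wedge_sign :: "'v::linorder \<Rightarrow> 'v set \<Rightarrow> ('v, 'k::comm_ring_1) mpoly" where
  "wedge_sign i S = (- 1) ^ card {j\<in>S. j < i}"

definition contract_rad :: "('v::linorder, 'k::comm_ring_1) form \<Rightarrow> ('v, 'k) form" where
  "contract_rad \<omega> =
     (\<Sum>S\<in>Poly_Mapping.keys \<omega>. \<Sum>i\<in>S.
        Poly_Mapping.single (S - {i}) (wedge_sign i S * var i * Poly_Mapping.lookup \<omega> S))"

definition ext_deriv :: "('v::{finite,linorder}, 'k::comm_ring_1) form \<Rightarrow> ('v, 'k) form" where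
  "ext_deriv \<omega> =
     (\<Sum>S\<in>Poly_Mapping.keys \<omega>. \<Sum>i\<in>-S.
        Poly_Mapping.single (insert i S) (wedge_sign i S * partial i (Poly_Mapping.lookup \<omega> S)))"

text \<open>
  The terms \<open>c x\<^sup>m dx\<^sub>S\<close> of a form are indexed by the pairs \<open>(S, m)\<close>; such a term has total degree
  \<open>card S + mon_degree m\<close>.
\<close>

definition form_terms :: "('v, 'k::zero) form \<Rightarrow> ('v set \<times> ('v \<Rightarrow>\<^sub>0 nat)) set" where
  "form_terms \<omega> = (SIGMA S:Poly_Mapping.keys \<omega>. Poly_Mapping.keys (Poly_Mapping.lookup \<omega> S))"

definition term_degree :: "'v::finite set \<times> ('v \<Rightarrow>\<^sub>0 nat) \<Rightarrow> nat" where
  "term_degree = (\<lambda>(S, m). card S + mon_degree m)"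

definition form_component :: "nat \<Rightarrow> ('v::finite, 'k::comm_monoid_add) form \<Rightarrow> ('v, 'k) form" where
  "form_component e \<omega> =
     (\<Sum>(S, m) | (S, m) \<in> form_terms \<omega> \<and> term_degree (S, m) = e.
        Poly_Mapping.single S (Poly_Mapping.single m (Poly_Mapping.lookup (Poly_Mapping.lookup \<omega> S) m)))"

text \<open>
  The sum runs over the total degrees occurring in \<open>\<omega>\<close>; degree \<open>0\<close> contributes \<open>0\<close>, as \<open>1 / 0 = 0\<close>.
\<close>

definition delta :: "('v::{finite,linorder}, 'k::field) form \<Rightarrow> ('v, 'k) form" where
  "delta \<omega> =
     (\<Sum>e\<in>term_degree ` form_terms \<omega>. const_poly (1 / of_nat e) \<bullet>\<^sub>f ext_deriv (form_component e \<omega>))"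


section \<open>Minimal graded free resolutions\<close>

text \<open>
  \<open>F\<^sub>i = \<Oplus>\<^sub>c R(- a i c)\<close>, \<open>c < b i\<close>, is free of rank \<open>b i\<close> on a homogeneous basis of degrees \<open>a i c\<close>, and
  \<open>\<phi> i\<close> is the matrix of \<open>F\<^sub>i \<rightarrow> F\<^bsub>i-1\<^esub>\<close>, respectively of \<open>F\<^sub>0 \<rightarrow> I \<subseteq> R\<close> for \<open>i = 0\<close>. The ranks may be \<open>0\<close>.
\<close>

definition minimal_graded_free_resolution ::
  "nat \<Rightarrow> ('v::finite, 'k::comm_ring_1) mpoly set \<Rightarrow> (nat \<Rightarrow> nat) \<Rightarrow> (nat \<Rightarrow> nat \<Rightarrow> int)
    \<Rightarrow> (nat \<Rightarrow> ('v, 'k) mpoly mat) \<Rightarrow> bool" where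
  "minimal_graded_free_resolution n I b a \<phi> \<longleftrightarrow>
     \<comment> \<open>shapes and degrees\<close>
     \<phi> 0 \<in> carrier_mat 1 (b 0) \<and>
     (\<forall>i\<in>{1..n}. \<phi> i \<in> carrier_mat (b (i - 1)) (b i)) \<and>
     (\<forall>c<b 0. homogeneous (a 0 c) (\<phi> 0 $$ (0, c))) \<and>
     (\<forall>i\<in>{1..n}. \<forall>r<b (i - 1). \<forall>c<b i. homogeneous (a i c - a (i - 1) r) (\<phi> i $$ (r, c))) \<and>
     \<comment> \<open>exactness at \<open>I\<close>, at \<open>F\<^sub>i\<close> for \<open>i < n\<close>, and at \<open>F\<^sub>n\<close>\<close>
     {(\<phi> 0 *\<^sub>v v) $ 0 | v. v \<in> carrier_vec (b 0)} = I \<and>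
     (\<forall>i<n. mat_kernel (\<phi> i) = {\<phi> (Suc i) *\<^sub>v v | v. v \<in> carrier_vec (b (Suc i))}) \<and>
     mat_kernel (\<phi> n) = {0\<^sub>v (b n)} \<and>
     \<comment> \<open>minimality\<close>
     (\<forall>i\<in>{1..n}. elements_mat (\<phi> i) \<subseteq> irrelevant_ideal)"


section \<open>The map \<open>\<xi>\<^sub>p\<close>\<close>

definition delta_mat ::
  "('v::{finite,linorder}, 'k::field) form mat \<Rightarrow> ('v, 'k) form mat" where
  "delta_mat G = map_mat delta G"

definition zero_form_mat :: "('v, 'k::zero) mpoly mat \<Rightarrow> ('v, 'k) form mat" where
  "zero_form_mat A = map_mat (Poly_Mapping.single {}) A"

definition mult_form_mat ::
  "('v, 'k::comm_semiring_1) mpoly mat \<Rightarrow> ('v, 'k) form mat \<Rightarrow> ('v, 'k) form mat" where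
  "mult_form_mat A G =
     mat (dim_row A) (dim_col G) (\<lambda>(i, j). \<Sum>l<dim_col A. A $$ (i, l) \<bullet>\<^sub>f G $$ (l, j))"

definition mult_form_mat_vec ::
  "('v, 'k::comm_semiring_1) form mat \<Rightarrow> 'k vec \<Rightarrow> ('v, 'k) form vec" where
  "mult_form_mat_vec G t =
     vec (dim_row G) (\<lambda>i. \<Sum>j<dim_col G. const_poly (t $ j) \<bullet>\<^sub>f G $$ (i, j))"

text \<open>\<open>nested_delta \<phi> i m = \<delta>(\<phi>\<^sub>i \<cdot> \<delta>(\<phi>\<^bsub>i+1\<^esub> \<cdots> \<delta>(\<phi>\<^bsub>i+m\<^esub>) \<cdots>))\<close>\<close>

primrec nested_delta ::
  "(nat \<Rightarrow> ('v::{finite,linorder}, 'k::field) mpoly mat) \<Rightarrow> nat \<Rightarrow> nat \<Rightarrow> ('v, 'k) form mat" where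
  "nested_delta \<phi> i 0 = delta_mat (zero_form_mat (\<phi> i))"
| "nested_delta \<phi> i (Suc m) = delta_mat (mult_form_mat (\<phi> i) (nested_delta \<phi> (Suc i) m))"

text \<open>
  \<open>Tor\<^sub>p(I\<^sub>Z, k) = F\<^sub>p \<otimes>\<^sub>R k\<close> is the space \<open>carrier_vec (b p)\<close> of columns of constants. The matrix
  \<open>\<phi>\<^sub>0 \<cdot> \<delta>(\<phi>\<^sub>1 \<cdots>)\<close> has a single row; \<open>xi\<close> is the only entry of its product with \<open>t\<close>. Only \<open>p \<ge> 1\<close> is
  meaningful.
\<close>

definition xi ::
  "(nat \<Rightarrow> ('v::{finite,linorder}, 'k::field) mpoly mat) \<Rightarrow> nat \<Rightarrow> 'k vec \<Rightarrow> ('v, 'k) form" where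
  "xi \<phi> p t = mult_form_mat_vec (mult_form_mat (\<phi> 0) (nested_delta \<phi> 1 (p - 1))) t $ 0"


section \<open>The target and the submodule\<close>

text \<open>
  \<open>twisted_forms_part p d I\<close> is \<open>H\<^sup>0(\<bbbP>\<^sup>n, \<Omega>\<^sup>p(d+p+1) \<otimes> \<I>\<^sub>Z)\<close>, written through the Euler sequence.
\<close>

definition twisted_forms_part ::
  "nat \<Rightarrow> nat \<Rightarrow> ('v::{finite,linorder}, 'k::comm_ring_1) mpoly set \<Rightarrow> ('v, 'k) form set" where
  "twisted_forms_part p d I =
     {\<omega> \<in> forms p. contract_rad \<omega> = 0 \<and>
        (\<forall>S. Poly_Mapping.lookup \<omega> S \<in> I \<and> homogeneous (int d + 1) (Poly_Mapping.lookup \<omega> S))}"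

text \<open>The direct sum \<open>\<A>\<^sup>p(Z)\<close> of these pieces over \<open>d \<ge> 0\<close>, inside \<open>\<Omega>\<^sup>p\<^sub>R\<close>.\<close>

definition twisted_forms ::
  "nat \<Rightarrow> ('v::{finite,linorder}, 'k::comm_ring_1) mpoly set \<Rightarrow> ('v, 'k) form set" where
  "twisted_forms p I = {(\<Sum>d\<in>D. w d) | D w. finite D \<and> (\<forall>d\<in>D. w d \<in> twisted_forms_part p d I)}"

text \<open>The submodule \<open>I\<^sub>Z \<cdot> \<iota>\<^bsub>rad\<^esub>(\<Omega>\<^bsup>p+1\<^esup>\<^sub>R)\<close>.\<close>

definition radial_submodule ::
  "nat \<Rightarrow> ('v::linorder, 'k::comm_ring_1) mpoly set \<Rightarrow> ('v, 'k) form set" where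
  "radial_submodule p I =
     {(\<Sum>i<N. F i \<bullet>\<^sub>f contract_rad (\<eta> i)) | (N::nat) F \<eta>. \<forall>i<N. F i \<in> I \<and> \<eta> i \<in> forms (p + 1)}"

end

theory Submission
  imports Defs
begin

text \<open>
  Two facts about forms carry the argument. Cartan's formula says that
  \<open>\<iota>\<^bsub>rad\<^esub> d + d \<iota>\<^bsub>rad\<^esub>\<close> multiplies every term by its total degree (\<open>cartan_formula\<close>, with Euler's identity).
  Dividing by the degree, \<open>\<iota>\<^bsub>rad\<^esub> (\<delta> \<omega>) = \<omega>\<close> whenever \<open>\<iota>\<^bsub>rad\<^esub> \<omega> = 0\<close> and \<open>\<omega>\<close> has no constant term
  (\<open>contract_rad_delta\<close>). Secondly, \<open>\<iota>\<^bsub>rad\<^esub>\<close> squares to zero and is \<open>R\<close>-linear, so that it commutes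
  with matrices of polynomials.

  Put \<open>G\<^sub>i = \<delta>(\<phi>\<^sub>i \<cdot> G\<^bsub>i+1\<^esub>)\<close> for \<open>i \<le> p\<close> and \<open>G\<^bsub>p+1\<^esub> = 1\<close>, so that \<open>\<xi>\<^sub>p(t) = \<phi>\<^sub>0 G\<^sub>1 t\<close>. By downward induction
  \<open>\<iota>\<^bsub>rad\<^esub> G\<^sub>i = \<phi>\<^sub>i G\<^bsub>i+1\<^esub>\<close> for \<open>1 \<le> i \<le> p\<close> (\<open>contract_rad_iterated_delta\<close>): the form \<open>\<phi>\<^sub>i G\<^bsub>i+1\<^esub>\<close> is killed by
  the contraction, since \<open>\<phi>\<^sub>i \<phi>\<^bsub>i+1\<^esub> = 0\<close> if \<open>i < p\<close> and since it consists of
  \<open>0\<close>-forms if \<open>i = p\<close>, and it has no constant term, since the entries of \<open>\<phi>\<^sub>i\<close> lie in the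
  irrelevant ideal. In particular \<open>\<iota>\<^bsub>rad\<^esub> (\<xi>\<^sub>p(t)) = \<phi>\<^sub>0 \<phi>\<^sub>1 G\<^sub>2 t = 0\<close>, and as the coefficients of \<open>\<xi>\<^sub>p(t)\<close> are
  combinations of the generators of \<open>I\<close>, it lies in the target.

  Injectivity and the intersection property both follow from the claim that \<open>\<xi>\<^sub>p(t) \<in> I \<cdot> \<iota>\<^bsub>rad\<^esub>(\<Omega>\<^bsup>p+1\<^esup>)\<close>
  forces \<open>t = 0\<close> (\<open>xi_radial_imp_zero\<close>), because \<open>0\<close> is in the submodule. As \<open>\<phi>\<^sub>0\<close> maps onto \<open>I\<close>, the
  hypothesis reads \<open>\<phi>\<^sub>0 (G\<^sub>1 t - \<iota>\<^bsub>rad\<^esub> H\<^sub>0) = 0\<close> for a column \<open>H\<^sub>0\<close> of forms. If \<open>\<phi>\<^bsub>i-1\<^esub> (G\<^sub>i t - \<iota>\<^bsub>rad\<^esub> H\<^bsub>i-1\<^esub>) = 0\<close>,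
  then exactness gives \<open>G\<^sub>i t - \<iota>\<^bsub>rad\<^esub> H\<^bsub>i-1\<^esub> = \<phi>\<^sub>i H\<^sub>i\<close>, and contracting once more gives
  \<open>\<phi>\<^sub>i (G\<^bsub>i+1\<^esub> t - \<iota>\<^bsub>rad\<^esub> H\<^sub>i) = 0\<close>. This climbs the resolution up to \<open>\<phi>\<^sub>p (t - \<iota>\<^bsub>rad\<^esub> H\<^sub>p) = 0\<close>. The \<open>0\<close>-form
  part of \<open>t - \<iota>\<^bsub>rad\<^esub> H\<^sub>p\<close> is therefore in the kernel of \<open>\<phi>\<^sub>p\<close>, so by exactness and minimality its entries are in the
  irrelevant ideal. So are those of the \<open>0\<close>-form part of \<open>\<iota>\<^bsub>rad\<^esub> H\<^sub>p\<close>, because contraction multiplies by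
  variables. Hence the constants \<open>t\<close> vanish.
\<close>

abbreviation "lookup \<equiv> Poly_Mapping.lookup"

section \<open>Coefficients and partial derivatives of polynomials\<close>

lemma lookup_single_mult:
  fixes f :: "('v, 'k::comm_ring_1) mpoly"
  shows "lookup (Poly_Mapping.single a c * f) (a + m) = c * lookup f m"
proof -
  have "lookup (Poly_Mapping.single a c * f) (a + m)
    = (\<Sum>l. (c when a = l) * (\<Sum>q. lookup f q when a + m = l + q))"
    by (simp add: lookup_mult lookup_single)
  also have "\<dots> = (\<Sum>l. (c * (\<Sum>q. lookup f q when a + m = l + q)) when a = l)"
    by (rule arg_cong[where f = Sum_any]) (auto simp: when_def)
  also have "\<dots> = c * lookup f m"
    by simp
  finally show ?thesis .
qed

lemma lookup_const_poly_mult: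
  fixes f :: "('v, 'k::comm_ring_1) mpoly"
  shows "lookup (const_poly c * f) m = c * lookup f m"
  using lookup_single_mult[of 0 c f m] by (simp add: const_poly_def)

lemma lookup_var_mult:
  fixes f :: "('v, 'k::comm_ring_1) mpoly"
  shows "lookup (var i * f) m =
    (if lookup m i = 0 then 0 else lookup f (m - Poly_Mapping.single i 1))"
proof (cases "lookup m i = 0")
  case True
  then have "m \<noteq> Poly_Mapping.single i 1 + q" for q
    by (metis One_nat_def add_is_0 lookup_add lookup_single_eq nat.simps(3))
  then have "(1 when Poly_Mapping.single i 1 = l) * (\<Sum>q. lookup f q when m = l + q) = 0" for l
    by (auto simp: when_def)
  then have "lookup (var i * f) m = 0"
    by (simp add: lookup_mult lookup_single var_def)
  with True show ?thesis by simp
next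
  case False
  then have "m = Poly_Mapping.single i 1 + (m - Poly_Mapping.single i 1)"
    by (intro poly_mapping_eqI) (auto simp: lookup_add lookup_minus lookup_single when_def)
  then show ?thesis
    using False lookup_single_mult[of "Poly_Mapping.single i 1" 1 f "m - Poly_Mapping.single i 1"]
    by (simp add: var_def)
qed

lemma lookup_partial:
  fixes f :: "('v, 'k::comm_ring_1) mpoly"
  shows "lookup (partial i f) m =
    of_nat (Suc (lookup m i)) * lookup f (m + Poly_Mapping.single i 1)"
proof -
  have shift: "l - Poly_Mapping.single i 1 = m \<longleftrightarrow> l = m + Poly_Mapping.single i 1"
    if "lookup l i \<noteq> 0" for l :: "'v \<Rightarrow>\<^sub>0 nat"
    using that
    by (auto intro!: poly_mapping_eqI simp: lookup_add lookup_minus lookup_single when_def)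
  have "lookup (partial i f) m = (\<Sum>l\<in>Poly_Mapping.keys f.
      if l = m + Poly_Mapping.single i 1 then of_nat (Suc (lookup m i)) * lookup f l else 0)"
    unfolding partial_def lookup_sum
  proof (rule sum.cong[OF refl])
    fix l
    show "lookup (Poly_Mapping.single (l - Poly_Mapping.single i 1)
        (of_nat (lookup l i) * lookup f l)) m
      = (if l = m + Poly_Mapping.single i 1 then of_nat (Suc (lookup m i)) * lookup f l else 0)"
    proof (cases "lookup l i = 0")
      case True
      then show ?thesis by (auto simp: lookup_add)
    next
      case False
      then show ?thesis
        by (simp only: lookup_single when_def shift[OF False]) (auto simp: lookup_add)
    qed
  qed
  then show ?thesis
    by (simp add: sum.delta in_keys_iff)
qed

lemma partial_add:
  fixes f g :: "('v, 'k::comm_ring_1) mpoly"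
  shows "partial i (f + g) = partial i f + partial i g"
  by (rule poly_mapping_eqI) (simp add: lookup_partial lookup_add algebra_simps)

lemma partial_zero [simp]: "partial i (0::('v, 'k::comm_ring_1) mpoly) = 0"
  by (rule poly_mapping_eqI) (simp add: lookup_partial)

lemma partial_sum:
  fixes f :: "'b \<Rightarrow> ('v, 'k::comm_ring_1) mpoly"
  shows "partial i (sum f A) = (\<Sum>x\<in>A. partial i (f x))"
  by (induction A rule: infinite_finite_induct) (simp_all add: partial_add)

lemma partial_const_poly_mult:
  fixes f :: "('v, 'k::comm_ring_1) mpoly"
  shows "partial i (const_poly c * f) = const_poly c * partial i f"
  by (rule poly_mapping_eqI) (simp add: lookup_partial lookup_const_poly_mult)

lemma partial_var_mult:
  fixes f :: "('v, 'k::comm_ring_1) mpoly"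
  shows "partial j (var i * f) = (if i = j then f else 0) + var i * partial j f"
proof (rule poly_mapping_eqI)
  fix m :: "'v \<Rightarrow>\<^sub>0 nat"
  show "lookup (partial j (var i * f)) m
      = lookup ((if i = j then f else 0) + var i * partial j f) m"
  proof (cases "i = j")
    case True
    have "lookup m j = 0 \<or> m - Poly_Mapping.single j 1 + Poly_Mapping.single j 1 = m"
      by (auto intro!: poly_mapping_eqI simp: lookup_add lookup_minus lookup_single when_def)
    then show ?thesis
      using True by (cases "lookup m j")
        (auto simp: lookup_partial lookup_var_mult lookup_add lookup_minus distrib_right)
  next
    case False
    have "lookup m i = 0 \<or> m + Poly_Mapping.single j 1 - Poly_Mapping.single i 1
        = (m - Poly_Mapping.single i 1) + Poly_Mapping.single j 1"
      by (auto intro!: poly_mapping_eqI simp: lookup_add lookup_minus lookup_single when_def)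
    then show ?thesis
      using False
      by (auto simp: lookup_partial lookup_var_mult lookup_add lookup_minus lookup_single when_def)
  qed
qed

lemma euler_identity:
  fixes f :: "('v::finite, 'k::comm_ring_1) mpoly"
  shows "lookup (\<Sum>i\<in>UNIV. var i * partial i f) m = of_nat (mon_degree m) * lookup f m"
proof -
  have "lookup (var i * partial i f) m = of_nat (lookup m i) * lookup f m" for i
  proof (cases "lookup m i = 0")
    case False
    then have "m - Poly_Mapping.single i 1 + Poly_Mapping.single i 1 = m"
      by (intro poly_mapping_eqI) (auto simp: lookup_add lookup_minus lookup_single when_def)
    with False show ?thesis
      by (simp add: lookup_var_mult lookup_partial lookup_minus del: of_nat_Suc)
  qed (simp add: lookup_var_mult)
  then show ?thesis
    by (simp add: lookup_sum mon_degree_def sum_distrib_right)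
qed

section \<open>Contraction and exterior derivative\<close>

lemma lookup_form_scale [simp]: "lookup (f \<bullet>\<^sub>f \<omega>) S = f * lookup \<omega> S"
  by (simp add: form_scale_def Poly_Mapping.map.rep_eq when_def)

interpretation form: module "form_scale :: ('v, 'k::comm_ring_1) mpoly \<Rightarrow> _"
  by unfold_locales (auto intro!: poly_mapping_eqI simp: lookup_add algebra_simps)

lemma wedge_sign_conv_const_poly:
  "(wedge_sign i S :: ('v::linorder, 'k::comm_ring_1) mpoly)
     = const_poly ((- 1) ^ card {j\<in>S. j < i})"
proof -
  have "(- 1) ^ q = (const_poly ((- 1) ^ q) :: ('v, 'k) mpoly)" for q
    by (induction q)
      (simp_all add: const_poly_def single_uminus)
  then show ?thesis by (simp add: wedge_sign_def)
qed

lemma partial_wedge_sign_mult: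
  fixes f :: "('v::linorder, 'k::comm_ring_1) mpoly"
  shows "partial i (wedge_sign j S * f) = wedge_sign j S * partial i f"
  by (simp add: wedge_sign_conv_const_poly partial_const_poly_mult)

lemma wedge_sign_insert:
  fixes S :: "'v::{finite,linorder} set"
  assumes "j \<notin> S"
  shows "(wedge_sign i (insert j S) :: ('v, 'k::comm_ring_1) mpoly)
    = (if j < i then - wedge_sign i S else wedge_sign i S)"
proof (cases "j < i")
  case True
  then have "{l \<in> insert j S. l < i} = insert j {l \<in> S. l < i}" by auto
  with assms True show ?thesis by (simp add: wedge_sign_def)
next
  case False
  then have "{l \<in> insert j S. l < i} = {l \<in> S. l < i}" by auto
  with False show ?thesis by (simp add: wedge_sign_def)
qed

lemma wedge_sign_insert_self [simp]: "wedge_sign i (insert i S) = wedge_sign i S"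
  unfolding wedge_sign_def by (rule arg_cong[where f = "\<lambda>A. (- 1) ^ card A"]) auto

lemma wedge_sign_Diff_self [simp]: "wedge_sign i (S - {i}) = wedge_sign i S"
  unfolding wedge_sign_def by (rule arg_cong[where f = "\<lambda>A. (- 1) ^ card A"]) auto

lemma wedge_sign_square [simp]: "wedge_sign i S * wedge_sign i S = 1"
  by (simp add: wedge_sign_def flip: power_mult_distrib)

lemma wedge_sign_cancel [simp]: "wedge_sign i S * (wedge_sign i S * f) = f"
  by (simp flip: mult.assoc)

lemma wedge_sign_swap:
  fixes S :: "'v::{finite,linorder} set"
  assumes "i \<notin> S" "j \<notin> S" "i \<noteq> j"
  shows "(wedge_sign i S * wedge_sign j (insert i S) :: ('v, 'k::comm_ring_1) mpoly)
    = - (wedge_sign j S * wedge_sign i (insert j S))"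
  using assms by (auto simp: wedge_sign_insert)

text \<open>
  The defining double sum, regrouped by the set \<open>T\<close> of the resulting term: the terms that contract to
  \<open>dx\<^sub>T\<close> come from \<open>dx\<^bsub>T \<union> {i}\<^esub>\<close> with \<open>i \<notin> T\<close>. All later computations with contraction and derivative use
  these coefficient formulas.
\<close>

lemma lookup_contract_rad:
  fixes \<omega> :: "('v::{finite,linorder}, 'k::comm_ring_1) form"
  shows "lookup (contract_rad \<omega>) T
    = (\<Sum>i\<in>-T. wedge_sign i T * (var i * lookup \<omega> (insert i T)))"
proof -
  let ?g = "\<lambda>S i. wedge_sign i S * var i * lookup \<omega> S"
  have "lookup (contract_rad \<omega>) T
    = (\<Sum>S\<in>Poly_Mapping.keys \<omega>. \<Sum>i\<in>S. if S - {i} = T then ?g S i else 0)"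
    by (simp add: contract_rad_def lookup_sum lookup_single when_def)
  also have "\<dots> = (\<Sum>S\<in>UNIV. \<Sum>i\<in>S. if S - {i} = T then ?g S i else 0)"
    by (rule sum.mono_neutral_left) (auto simp: in_keys_iff intro!: sum.neutral)
  also have "\<dots> = (\<Sum>(S, i)\<in>(SIGMA S:UNIV. S). if S - {i} = T then ?g S i else 0)"
    by (simp add: sum.Sigma)
  also have "\<dots> = (\<Sum>(S, i)\<in>(\<lambda>i. (insert i T, i)) ` (- T). ?g S i)"
    by (rule sum.mono_neutral_cong_right) auto
  also have "\<dots> = (\<Sum>i\<in>-T. wedge_sign i T * (var i * lookup \<omega> (insert i T)))"
    by (subst sum.reindex) (auto intro: inj_onI simp: mult.assoc)
  finally show ?thesis .
qed

lemma lookup_ext_deriv: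
  fixes \<omega> :: "('v::{finite,linorder}, 'k::comm_ring_1) form"
  shows "lookup (ext_deriv \<omega>) T = (\<Sum>i\<in>T. wedge_sign i T * partial i (lookup \<omega> (T - {i})))"
proof -
  let ?g = "\<lambda>S i. wedge_sign i S * partial i (lookup \<omega> S)"
  have "lookup (ext_deriv \<omega>) T
    = (\<Sum>S\<in>Poly_Mapping.keys \<omega>. \<Sum>i\<in>-S. if insert i S = T then ?g S i else 0)"
    by (simp add: ext_deriv_def lookup_sum lookup_single when_def)
  also have "\<dots> = (\<Sum>S\<in>UNIV. \<Sum>i\<in>-S. if insert i S = T then ?g S i else 0)"
    by (rule sum.mono_neutral_left) (auto simp: in_keys_iff intro!: sum.neutral)
  also have "\<dots> = (\<Sum>(S, i)\<in>(SIGMA S:UNIV. -S). if insert i S = T then ?g S i else 0)"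
    by (simp add: sum.Sigma)
  also have "\<dots> = (\<Sum>(S, i)\<in>(\<lambda>i. (T - {i}, i)) ` T. ?g S i)"
    by (rule sum.mono_neutral_cong_right) auto
  also have "\<dots> = (\<Sum>i\<in>T. wedge_sign i T * partial i (lookup \<omega> (T - {i})))"
    by (subst sum.reindex) (auto intro: inj_onI)
  finally show ?thesis .
qed

interpretation contract_rad: module_hom form_scale form_scale
  "contract_rad :: ('v::{finite,linorder}, 'k::comm_ring_1) form \<Rightarrow> _"
  by unfold_locales
    (auto intro!: poly_mapping_eqI
      simp: lookup_add lookup_contract_rad sum.distrib sum_distrib_left algebra_simps)

lemma ext_deriv_const_scale:
  fixes \<omega> :: "('v::{finite,linorder}, 'k::comm_ring_1) form"
  shows "ext_deriv (const_poly c \<bullet>\<^sub>f \<omega>) = const_poly c \<bullet>\<^sub>f ext_deriv \<omega>"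
  by (rule poly_mapping_eqI)
    (simp add: lookup_ext_deriv partial_const_poly_mult sum_distrib_left mult.left_commute)

lemma ext_deriv_sum:
  fixes \<omega> :: "'b \<Rightarrow> ('v::{finite,linorder}, 'k::comm_ring_1) form"
  shows "ext_deriv (sum \<omega> A) = (\<Sum>x\<in>A. ext_deriv (\<omega> x))"
proof (rule poly_mapping_eqI)
  fix T
  show "lookup (ext_deriv (sum \<omega> A)) T = lookup (\<Sum>x\<in>A. ext_deriv (\<omega> x)) T"
    by (simp add: lookup_ext_deriv lookup_sum partial_sum sum_distrib_left, rule sum.swap)
qed

lemma ext_deriv_zero [simp]: "ext_deriv (0::('v::{finite,linorder}, 'k::comm_ring_1) form) = 0"
  by (simp add: ext_deriv_def)

text \<open>
  In the double sum for the coefficient of \<open>dx\<^sub>T\<close>, the term of \<open>(i, j)\<close> contains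
  \<open>x\<^sub>i x\<^sub>j\<close> times the coefficient of \<open>dx\<^bsub>T \<union> {i, j}\<^esub>\<close>, which is symmetric, and a sign that is
  antisymmetric by \<open>wedge_sign_swap\<close>. So the sum is its own negative.
\<close>

lemma contract_rad_contract_rad:
  fixes \<omega> :: "('v::{finite,linorder}, 'k::field_char_0) form"
  shows "contract_rad (contract_rad \<omega>) = 0"
proof (rule poly_mapping_eqI)
  fix T
  define h where "h i j = wedge_sign i T * wedge_sign j (insert i T) *
    (var i * var j * lookup \<omega> (insert i (insert j T)))" for i j
  have *: "lookup (contract_rad (contract_rad \<omega>)) T = (\<Sum>i\<in>-T. \<Sum>j\<in>-T - {i}. h i j)"
    unfolding lookup_contract_rad h_def sum_distrib_left
    by (intro sum.cong) (auto simp: ac_simps insert_commute)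
  have **: "(\<Sum>i\<in>-T. \<Sum>j\<in>-T - {i}. h i j) = (\<Sum>i\<in>-T. \<Sum>j\<in>-T. if i = j then 0 else h i j)"
    by (intro sum.cong refl sum.mono_neutral_cong_left) auto
  have anti: "(if i = j then 0 else h i j) = - (if j = i then 0 else h j i)"
    if "i \<in> -T" "j \<in> -T" for i j
    using that wedge_sign_swap[of i T j, where 'k = 'k]
    by (simp add: h_def ac_simps insert_commute)
  define s where "s = (\<Sum>i\<in>-T. \<Sum>j\<in>-T. if i = j then 0 else h i j)"
  have "s = (\<Sum>i\<in>-T. \<Sum>j\<in>-T. - (if j = i then 0 else h j i))"
    unfolding s_def by (intro sum.cong refl anti)
  also have "\<dots> = - s"
    unfolding s_def sum_negf by (subst sum.swap) simp
  finally have "lookup s m = - lookup s m" for m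
    by (metis lookup_uminus)
  then have "s = 0"
    by (intro poly_mapping_eqI) (simp add: eq_neg_iff_add_eq_0)
  then show "lookup (contract_rad (contract_rad \<omega>)) T = lookup 0 T"
    by (simp add: * ** s_def)
qed

text \<open>
  The right-hand side is the total degree acting on the coefficient of \<open>dx\<^sub>T\<close>, once Euler's identity is
  applied. In both compositions the pairs \<open>i = j\<close> give the diagonal part: \<open>x\<^sub>i \<partial>\<^sub>i\<close> for
  \<open>i \<notin> T\<close> from contracting the derivative, \<open>\<partial>\<^sub>j x\<^sub>j = 1 + x\<^sub>j \<partial>\<^sub>j\<close> for \<open>j \<in> T\<close> from deriving the contraction.
  The pairs \<open>i \<noteq> j\<close> occur in both with opposite signs and cancel.
\<close>

lemma cartan_formula:
  fixes \<omega> :: "('v::{finite,linorder}, 'k::comm_ring_1) form"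
  shows "lookup (contract_rad (ext_deriv \<omega>) + ext_deriv (contract_rad \<omega>)) T
    = of_nat (card T) * lookup \<omega> T + (\<Sum>i\<in>UNIV. var i * partial i (lookup \<omega> T))"
proof -
  \<comment> \<open>The off-diagonal term of \<open>\<iota>\<^bsub>rad\<^esub> d\<close> at \<open>i \<notin> T\<close>, \<open>j \<in> T\<close>; it reappears negated in \<open>d \<iota>\<^bsub>rad\<^esub>\<close>.\<close>
  define g where "g i j = wedge_sign i T * wedge_sign j (insert i T) *
    (var i * partial j (lookup \<omega> (insert i T - {j})))" for i j
  define D where "D = (\<lambda>i. var i * partial i (lookup \<omega> T))"
  have "lookup (contract_rad (ext_deriv \<omega>)) T = (\<Sum>i\<in>-T. D i + (\<Sum>j\<in>T. g i j))"
    unfolding lookup_contract_rad lookup_ext_deriv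
  proof (rule sum.cong[OF refl])
    fix i assume "i \<in> -T"
    then show "wedge_sign i T * (var i * (\<Sum>j\<in>insert i T. wedge_sign j (insert i T) *
      partial j (lookup \<omega> (insert i T - {j})))) = D i + (\<Sum>j\<in>T. g i j)"
      by (simp add: distrib_left sum_distrib_left g_def D_def mult_ac)
  qed
  moreover have "lookup (ext_deriv (contract_rad \<omega>)) T
    = (\<Sum>j\<in>T. lookup \<omega> T + D j - (\<Sum>i\<in>-T. g i j))"
    unfolding lookup_contract_rad lookup_ext_deriv
  proof (rule sum.cong[OF refl])
    fix j assume j: "j \<in> T"
    have comm: "wedge_sign i (T - {j}) * wedge_sign j T
        = (- (wedge_sign i T * wedge_sign j (insert i T)) :: ('v, 'k) mpoly)" if "i \<in> -T" for i
      using wedge_sign_swap[of i "T - {j}" j, where 'k = 'k] j that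
      by (auto simp: insert_absorb wedge_sign_insert insert_Diff_if) (metis mult.commute)+
    have sign: "wedge_sign j T * (wedge_sign i (T - {j}) * f)
        = - (wedge_sign i T * wedge_sign j (insert i T) * f)" if "i \<in> -T"
        for i and f :: "('v, 'k) mpoly"
    proof -
      have "wedge_sign j T * (wedge_sign i (T - {j}) * f)
          = (wedge_sign i (T - {j}) * wedge_sign j T) * f"
        by (simp only: mult_ac)
      then show ?thesis by (simp only: comm[OF that] mult_minus_left)
    qed
    let ?p = "\<lambda>i. partial j (lookup \<omega> (insert i (T - {j})))"
    have swap: "wedge_sign j T * (wedge_sign i (T - {j}) * (var i * ?p i)) = - g i j"
      if "i \<in> -T" for i
    proof -
      have "insert i (T - {j}) = insert i T - {j}" using that j by auto
      then show ?thesis by (simp only: sign[OF that] g_def)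
    qed
    have "partial j (\<Sum>i\<in>- (T - {j}). wedge_sign i (T - {j}) *
        (var i * lookup \<omega> (insert i (T - {j}))))
      = (\<Sum>i\<in>insert j (-T). wedge_sign i (T - {j}) *
          ((if i = j then lookup \<omega> T else 0) + var i * ?p i))"
      unfolding partial_sum partial_wedge_sign_mult partial_var_mult
      using j by (intro sum.cong) (auto simp: insert_absorb)
    also have "\<dots> = wedge_sign j T * (lookup \<omega> T + D j) +
        (\<Sum>i\<in>-T. wedge_sign i (T - {j}) * (var i * ?p i))"
      using j by (subst sum.insert) (auto simp: D_def insert_absorb intro!: sum.cong)
    finally have "wedge_sign j T * partial j (\<Sum>i\<in>- (T - {j}). wedge_sign i (T - {j}) *
        (var i * lookup \<omega> (insert i (T - {j}))))
      = wedge_sign j T * (wedge_sign j T * (lookup \<omega> T + D j)) +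
        (\<Sum>i\<in>-T. wedge_sign j T * (wedge_sign i (T - {j}) * (var i * ?p i)))"
      by (simp only: distrib_left sum_distrib_left)
    also have "\<dots> = lookup \<omega> T + D j - (\<Sum>i\<in>-T. g i j)"
      by (simp add: swap sum_negf)
    finally show "wedge_sign j T * partial j (\<Sum>i\<in>- (T - {j}). wedge_sign i (T - {j}) *
        (var i * lookup \<omega> (insert i (T - {j})))) = lookup \<omega> T + D j - (\<Sum>i\<in>-T. g i j)" .
  qed
  moreover have "(\<Sum>i\<in>-T. \<Sum>j\<in>T. g i j) = (\<Sum>j\<in>T. \<Sum>i\<in>-T. g i j)"
    by (rule sum.swap)
  moreover have "(\<Sum>i\<in>UNIV. D i) = (\<Sum>i\<in>-T. D i) + (\<Sum>i\<in>T. D i)"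
    by (subst sum.union_disjoint[symmetric]) (auto intro!: arg_cong[where f = "sum D"])
  ultimately show ?thesis
    by (simp add: lookup_add sum.distrib sum_subtractf D_def)
qed

section \<open>Inverting the exterior derivative\<close>

lemma lookup_form_component:
  fixes \<omega> :: "('v::finite, 'k::comm_monoid_add) form"
  shows "lookup (lookup (form_component e \<omega>) S) m
    = (if card S + mon_degree m = e then lookup (lookup \<omega> S) m else 0)"
proof -
  have fin: "finite (form_terms \<omega>)"
    by (simp add: form_terms_def finite_SigmaI)
  have "lookup (lookup (form_component e \<omega>) S) m
    = (\<Sum>x | x \<in> form_terms \<omega> \<and> term_degree x = e.
        if x = (S, m) then lookup (lookup \<omega> S) m else 0)"
    unfolding form_component_def lookup_sum
    by (intro sum.cong) (auto simp: lookup_sum lookup_single when_def split: prod.splits)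
  also have "\<dots> = (if (S, m) \<in> form_terms \<omega> \<and> term_degree (S, m) = e
      then lookup (lookup \<omega> S) m else 0)"
    using fin by (subst sum.delta) auto
  finally show ?thesis
    by (auto simp: form_terms_def term_degree_def in_keys_iff)
qed

text \<open>
  Contraction trades a \<open>dx\<^sub>i\<close> for an \<open>x\<^sub>i\<close>, so it preserves the total degree.
\<close>

lemma contract_rad_form_component:
  fixes \<omega> :: "('v::{finite,linorder}, 'k::comm_ring_1) form"
  shows "contract_rad (form_component e \<omega>) = form_component e (contract_rad \<omega>)"
proof (intro poly_mapping_eqI)
  fix T :: "'v set" and m :: "'v \<Rightarrow>\<^sub>0 nat"
  have "lookup (wedge_sign i T * (var i * lookup (form_component e \<omega>) (insert i T))) m
    = (if card T + mon_degree m = e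
       then lookup (wedge_sign i T * (var i * lookup \<omega> (insert i T))) m else 0)" if "i \<notin> T" for i
  proof (cases "lookup m i = 0")
    case False
    have "mon_degree m = Suc (mon_degree (m - Poly_Mapping.single i 1))"
      using False
      by (simp add: mon_degree_def lookup_minus lookup_single when_def sum.remove[of UNIV i])
    with False that show ?thesis
      by (simp add: wedge_sign_conv_const_poly lookup_const_poly_mult lookup_var_mult
          lookup_form_component)
  qed (simp add: wedge_sign_conv_const_poly lookup_const_poly_mult lookup_var_mult)
  then show "lookup (lookup (contract_rad (form_component e \<omega>)) T) m
      = lookup (lookup (form_component e (contract_rad \<omega>)) T) m"
    by (simp add: lookup_form_component lookup_contract_rad lookup_sum)
qed

text \<open>
  Write \<open>\<delta> \<omega> = d \<theta>\<close>, where \<open>\<theta>\<close> is \<open>\<omega>\<close> with every term divided by its total degree. Contraction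
  preserves degrees, so \<open>\<iota>\<^bsub>rad\<^esub> \<theta> = 0\<close>, and Cartan's formula turns \<open>\<iota>\<^bsub>rad\<^esub> (d \<theta>)\<close> into \<open>\<theta>\<close> with every term
  multiplied by its degree. Only a constant term, of degree \<open>0\<close>, would be lost.
\<close>

lemma contract_rad_delta:
  fixes \<omega> :: "('v::{finite,linorder}, 'k::field_char_0) form"
  assumes rad: "contract_rad \<omega> = 0" and const: "lookup (lookup \<omega> {}) 0 = 0"
  shows "contract_rad (delta \<omega>) = \<omega>"
proof -
  define E where "E = term_degree ` form_terms \<omega>"
  define \<theta> where "\<theta> = (\<Sum>e\<in>E. const_poly (1 / of_nat e) \<bullet>\<^sub>f form_component e \<omega>)"
  have "finite E"
    by (simp add: E_def form_terms_def finite_SigmaI)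
  have delta: "delta \<omega> = ext_deriv \<theta>"
    by (simp add: delta_def \<theta>_def E_def ext_deriv_sum ext_deriv_const_scale)
  have "form_component e 0 = (0 :: ('v, 'k) form)" for e
    by (simp add: form_component_def form_terms_def)
  then have rad_\<theta>: "contract_rad \<theta> = 0"
    by (simp add: \<theta>_def contract_rad.sum contract_rad.scale contract_rad_form_component rad)
  have lookup_\<theta>: "of_nat (card S + mon_degree m) * lookup (lookup \<theta> S) m = lookup (lookup \<omega> S) m"
    for S m
  proof -
    have "lookup (lookup \<theta> S) m
      = (\<Sum>e\<in>E. if card S + mon_degree m = e then lookup (lookup \<omega> S) m / of_nat e else 0)"
      unfolding \<theta>_def
      by (simp add: lookup_sum lookup_const_poly_mult lookup_form_component)
         (intro sum.cong, auto)
    also have "\<dots> = (if card S + mon_degree m \<in> E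
        then lookup (lookup \<omega> S) m / of_nat (card S + mon_degree m) else 0)"
      using \<open>finite E\<close> by (simp add: sum.delta)
    finally have *: "lookup (lookup \<theta> S) m = (if card S + mon_degree m \<in> E
        then lookup (lookup \<omega> S) m / of_nat (card S + mon_degree m) else 0)" .
    show ?thesis
    proof (cases "lookup (lookup \<omega> S) m = 0")
      case False
      then have "(S, m) \<in> form_terms \<omega>"
        by (auto simp: form_terms_def in_keys_iff)
      then have "card S + mon_degree m \<in> E"
        unfolding E_def by (rule rev_image_eqI) (simp add: term_degree_def)
      moreover have "card S + mon_degree m \<noteq> 0"
      proof
        assume "card S + mon_degree m = 0"
        then have "S = {}" "m = 0"
          by (auto simp: mon_degree_def intro!: poly_mapping_eqI)
        with const False show False by simp
      qed
      ultimately show ?thesis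
        using * by (simp del: of_nat_add)
    qed (simp add: *)
  qed
  show ?thesis
  proof (intro poly_mapping_eqI)
    fix T :: "'v set" and m :: "'v \<Rightarrow>\<^sub>0 nat"
    have "lookup (contract_rad (delta \<omega>)) T
      = of_nat (card T) * lookup \<theta> T + (\<Sum>i\<in>UNIV. var i * partial i (lookup \<theta> T))"
      using cartan_formula[of \<theta> T] by (simp add: delta rad_\<theta>)
    moreover have "lookup (of_nat q * f) m = of_nat q * lookup f m" for q and f :: "('v, 'k) mpoly"
      by (induction q) (simp_all add: lookup_add distrib_right)
    ultimately show "lookup (lookup (contract_rad (delta \<omega>)) T) m = lookup (lookup \<omega> T) m"
      using lookup_\<theta>[of T m] by (simp add: lookup_add euler_identity distrib_right)
  qed
qed

lemma delta_in_forms: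
  fixes \<omega> :: "('v::{finite,linorder}, 'k::field) form"
  assumes "\<omega> \<in> forms q"
  shows "delta \<omega> \<in> forms (Suc q)"
proof -
  have vanish: "lookup (ext_deriv (form_component e \<omega>)) T = 0" if "card T \<noteq> Suc q" for e T
  proof -
    have "lookup (form_component e \<omega>) (T - {i}) = 0" if "i \<in> T" for i
    proof -
      have "card (T - {i}) \<noteq> q"
        using \<open>card T \<noteq> Suc q\<close> that by (metis card_Suc_Diff1 finite)
      then have "lookup \<omega> (T - {i}) = 0"
        using assms by (auto simp: forms_def in_keys_iff)
      then show ?thesis
        by (intro poly_mapping_eqI) (simp add: lookup_form_component)
    qed
    then show ?thesis
      by (simp add: lookup_ext_deriv)
  qed
  have "lookup (delta \<omega>) T = 0" if "card T \<noteq> Suc q" for T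
    by (simp add: delta_def lookup_sum vanish[OF that])
  then show ?thesis
    by (auto simp: forms_def in_keys_iff)
qed

section \<open>Membership in the space of twisted forms\<close>

lemma forms_sum:
  assumes "\<And>x. x \<in> A \<Longrightarrow> \<omega> x \<in> forms q"
  shows "sum \<omega> A \<in> forms q"
  using assms
  by (fastforce simp: forms_def in_keys_iff lookup_sum intro: sum.neutral dest: sum.not_neutral_contains_not_neutral)

lemma forms_scale:
  "\<omega> \<in> forms q \<Longrightarrow> f \<bullet>\<^sub>f \<omega> \<in> forms q"
  by (auto simp: forms_def in_keys_iff)

lemma contract_rad_in_forms:
  fixes \<omega> :: "('v::{finite,linorder}, 'k::comm_ring_1) form"
  assumes "\<omega> \<in> forms (Suc q)"
  shows "contract_rad \<omega> \<in> forms q"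
proof -
  have "lookup (contract_rad \<omega>) T = 0" if "card T \<noteq> q" for T
  proof -
    have "lookup \<omega> (insert i T) = 0" if "i \<notin> T" for i
    proof -
      have "card (insert i T) \<noteq> Suc q"
        using that \<open>card T \<noteq> q\<close> by simp
      then show ?thesis
        using assms by (auto simp: forms_def in_keys_iff)
    qed
    then show ?thesis
      by (simp add: lookup_contract_rad)
  qed
  then show ?thesis
    by (auto simp: forms_def in_keys_iff)
qed

lemma lookup_poly_component:
  fixes f :: "('v::finite, 'k::comm_monoid_add) mpoly"
  shows "lookup (poly_component d f) m = (if mon_degree m = d then lookup f m else 0)"
proof -
  have "lookup (poly_component d f) m
    = (\<Sum>l | l \<in> Poly_Mapping.keys f \<and> mon_degree l = d. if l = m then lookup f m else 0)"
    unfolding poly_component_def lookup_sum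
    by (intro sum.cong) (auto simp: lookup_single when_def)
  then show ?thesis
    by (auto simp: sum.delta in_keys_iff)
qed

text \<open>
  For \<open>i \<in> S\<close>, the monomial \<open>x\<^sub>i dx\<^bsub>S - {i}\<^esub>\<close> of \<open>\<iota>\<^bsub>rad\<^esub> \<omega>\<close> can only come from a constant multiple of \<open>dx\<^sub>S\<close>.
\<close>

lemma constant_coefficient_radial_form:
  fixes \<omega> :: "('v::{finite,linorder}, 'k::comm_ring_1) form"
  assumes "contract_rad \<omega> = 0" and "S \<noteq> {}"
  shows "lookup (lookup \<omega> S) 0 = 0"
proof -
  obtain i where "i \<in> S" using assms(2) by auto
  let ?x = "Poly_Mapping.single i (1::nat)"
  have "0 = lookup (lookup (contract_rad \<omega>) (S - {i})) ?x"
    by (simp add: assms(1))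
  also have "\<dots> = (\<Sum>j\<in>-(S - {i}). if j = i
      then (- 1) ^ card {l \<in> S - {i}. l < i} * lookup (lookup \<omega> S) 0 else 0)"
    unfolding lookup_contract_rad lookup_sum
    using \<open>i \<in> S\<close>
    by (intro sum.cong) (auto simp: wedge_sign_conv_const_poly lookup_const_poly_mult lookup_var_mult
        lookup_single when_def insert_absorb)
  also have "\<dots> = (- 1) ^ card {l \<in> S - {i}. l < i} * lookup (lookup \<omega> S) 0"
    by (simp add: sum.delta)
  finally show ?thesis
    by (metis (no_types, lifting) mult_zero_right mult.assoc mult_1 power_mult_distrib
        minus_mult_minus mult_1_right power_one)
qed

text \<open>
  The summands are the components of \<open>\<omega>\<close> of total degree \<open>p + d + 1\<close>; they stay in \<open>I\<close> because \<open>I\<close> is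
  homogeneous. The summation over \<open>d \<ge> 0\<close> misses the \<open>p\<close>-forms with constant coefficients, which do not
  occur here by \<open>constant_coefficient_radial_form\<close>.
\<close>

lemma twisted_formsI:
  fixes \<omega> :: "('v::{finite,linorder}, 'k::comm_ring_1) form"
  assumes "homogeneous_ideal I" and "1 \<le> p"
    and \<omega>: "\<omega> \<in> forms p" "contract_rad \<omega> = 0" "\<And>S. lookup \<omega> S \<in> I"
  shows "\<omega> \<in> twisted_forms p I"
proof -
  define D where "D = {d. p + d + 1 \<in> term_degree ` form_terms \<omega>}"
  have "finite (term_degree ` form_terms \<omega>)"
    by (simp add: form_terms_def finite_SigmaI)
  then have "finite D"
    unfolding D_def by (rule finite_vimageI[unfolded vimage_def]) (auto intro: injI)
  have zero: "lookup \<omega> S = 0" if "card S \<noteq> p" for S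
    using \<omega>(1) that by (auto simp: forms_def in_keys_iff)
  have comp: "lookup (form_component (p + d + 1) \<omega>) S = poly_component (d + 1) (lookup \<omega> S)" for d S
    by (rule poly_mapping_eqI, cases "card S = p")
      (auto simp: lookup_form_component lookup_poly_component zero)
  have "form_component (p + d + 1) \<omega> \<in> twisted_forms_part p d I" for d
  proof -
    have "form_component (p + d + 1) \<omega> \<in> forms p"
    proof -
      have "lookup (form_component (p + d + 1) \<omega>) S = 0" if "card S \<noteq> p" for S
        by (rule poly_mapping_eqI) (simp add: lookup_form_component zero[OF that])
      then show ?thesis
        by (auto simp: forms_def in_keys_iff)
    qed
    moreover have "contract_rad (form_component (p + d + 1) \<omega>) = 0"
      by (simp add: contract_rad_form_component \<omega>(2)) (simp add: form_component_def form_terms_def)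
    moreover have "lookup (form_component (p + d + 1) \<omega>) S \<in> I" for S
      using assms(1) \<omega>(3) by (simp only: comp homogeneous_ideal_def)
    moreover have "homogeneous (int d + 1) (lookup (form_component (p + d + 1) \<omega>) S)" for S
      unfolding comp by (auto simp: homogeneous_def in_keys_iff lookup_poly_component split: if_splits)
    ultimately show ?thesis
      by (simp add: twisted_forms_part_def)
  qed
  moreover have "\<omega> = (\<Sum>d\<in>D. form_component (p + d + 1) \<omega>)"
  proof (intro poly_mapping_eqI)
    fix S :: "'v set" and m :: "'v \<Rightarrow>\<^sub>0 nat"
    show "lookup (lookup \<omega> S) m = lookup (lookup (\<Sum>d\<in>D. form_component (p + d + 1) \<omega>) S) m"
    proof (cases "lookup (lookup \<omega> S) m = 0")
      case True
      then show ?thesis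
        by (simp add: lookup_sum lookup_form_component)
    next
      case False
      then have "card S = p" using zero by force
      moreover have "S \<noteq> {}" using \<open>card S = p\<close> \<open>1 \<le> p\<close> by auto
      then have "m \<noteq> 0"
        using constant_coefficient_radial_form[OF \<omega>(2)] False by auto
      then have "mon_degree m \<noteq> 0"
        by (auto simp: mon_degree_def intro!: poly_mapping_eqI)
      then obtain d where d: "mon_degree m = d + 1"
        by (cases "mon_degree m") auto
      have "(S, m) \<in> form_terms \<omega>"
        using False by (auto simp: form_terms_def in_keys_iff)
      then have "d \<in> D"
        unfolding D_def using \<open>card S = p\<close> d
        by (auto simp: term_degree_def intro!: rev_image_eqI[of "(S, m)"])
      have "lookup (lookup (\<Sum>d\<in>D. form_component (p + d + 1) \<omega>) S) m
        = (\<Sum>d'\<in>D. if d' = d then lookup (lookup \<omega> S) m else 0)"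
        unfolding lookup_sum lookup_form_component
        by (intro sum.cong) (auto simp: \<open>card S = p\<close> d)
      with \<open>d \<in> D\<close> \<open>finite D\<close> show ?thesis
        by (simp add: sum.delta)
    qed
  qed
  ultimately show ?thesis
    using \<open>finite D\<close> unfolding twisted_forms_def
    by (intro CollectI exI[of _ D] exI[of _ "\<lambda>d. form_component (p + d + 1) \<omega>"]) auto
qed
section \<open>Matrices acting on forms\<close>

text \<open>
  A column of forms is a function on indices, of which only the values below \<open>dim_col A\<close> matter. This
  makes columns of any length available without carrier conditions.
\<close>

definition mat_form_mult ::
  "('v, 'k::comm_semiring_1) mpoly mat \<Rightarrow> (nat \<Rightarrow> ('v, 'k) form) \<Rightarrow> nat \<Rightarrow> ('v, 'k) form" where
  "mat_form_mult A \<omega> r = (\<Sum>l<dim_col A. A $$ (r, l) \<bullet>\<^sub>f \<omega> l)"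

text \<open>
  A matrix acts on the coefficients of each \<open>dx\<^sub>S\<close> separately, so exactness of a complex of free
  \<open>R\<close>-modules passes to columns of forms.
\<close>

lemma lookup_mat_form_mult:
  fixes A :: "('v, 'k::comm_ring_1) mpoly mat"
  assumes "r < dim_row A"
  shows "lookup (mat_form_mult A \<omega> r) S = (A *\<^sub>v vec (dim_col A) (\<lambda>l. lookup (\<omega> l) S)) $ r"
  using assms by (simp add: mat_form_mult_def lookup_sum scalar_prod_def lessThan_atLeast0)

lemma mat_form_mult_diff:
  fixes A :: "('v, 'k::comm_ring_1) mpoly mat"
  shows "mat_form_mult A (\<lambda>l. \<omega> l - \<eta> l) r = mat_form_mult A \<omega> r - mat_form_mult A \<eta> r"
  by (simp add: mat_form_mult_def form.scale_right_diff_distrib sum_subtractf)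

lemma mat_form_mult_cong:
  "(\<And>l. l < dim_col A \<Longrightarrow> \<omega> l = \<eta> l) \<Longrightarrow> mat_form_mult A \<omega> r = mat_form_mult A \<eta> r"
  by (simp add: mat_form_mult_def)

lemma mat_form_mult_sum_scale:
  fixes A :: "('v, 'k::comm_ring_1) mpoly mat"
  shows "mat_form_mult A (\<lambda>l. \<Sum>j\<in>J. c j \<bullet>\<^sub>f \<omega> l j) r
    = (\<Sum>j\<in>J. c j \<bullet>\<^sub>f mat_form_mult A (\<lambda>l. \<omega> l j) r)"
  unfolding mat_form_mult_def form.scale_sum_right
  by (subst sum.swap) (simp add: mult.commute)

lemma contract_rad_mat_form_mult:
  fixes A :: "('v::{finite,linorder}, 'k::comm_ring_1) mpoly mat"
  shows "contract_rad (mat_form_mult A \<omega> r) = mat_form_mult A (\<lambda>l. contract_rad (\<omega> l)) r"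
  by (simp add: mat_form_mult_def contract_rad.sum contract_rad.scale)

lemma mat_form_mult_complex:
  fixes A :: "('v, 'k::comm_ring_1) mpoly mat"
  assumes A: "A \<in> carrier_mat m k" and B: "B \<in> carrier_mat k l"
    and exact: "mat_kernel A = {B *\<^sub>v v | v. v \<in> carrier_vec l}"
    and r: "r < m"
  shows "mat_form_mult A (mat_form_mult B \<omega>) r = 0"
proof (rule poly_mapping_eqI)
  fix S
  let ?v = "vec l (\<lambda>c. lookup (\<omega> c) S)"
  have "vec k (\<lambda>c. lookup (mat_form_mult B \<omega> c) S) = B *\<^sub>v ?v"
    using B by (intro eq_vecI) (auto simp: lookup_mat_form_mult)
  moreover have "B *\<^sub>v ?v \<in> mat_kernel A"
    unfolding exact by auto
  then have "A *\<^sub>v (B *\<^sub>v ?v) = 0\<^sub>v m"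
    using A by (simp add: mat_kernel_def)
  ultimately show "lookup (mat_form_mult A (mat_form_mult B \<omega>) r) S = lookup 0 S"
    using A r by (simp add: lookup_mat_form_mult)
qed

text \<open>
  A preimage is chosen for every \<open>S\<close> separately, and the choices are assembled into forms.
\<close>

lemma mat_form_mult_exact:
  fixes A :: "('v::finite, 'k::comm_ring_1) mpoly mat"
  assumes A: "A \<in> carrier_mat m k" and B: "B \<in> carrier_mat k l"
    and exact: "mat_kernel A = {B *\<^sub>v v | v. v \<in> carrier_vec l}"
    and zero: "\<And>r. r < m \<Longrightarrow> mat_form_mult A \<omega> r = 0"
  obtains \<eta> where "\<And>c. c < k \<Longrightarrow> \<omega> c = mat_form_mult B \<eta> c"
proof -
  have "\<exists>v\<in>carrier_vec l. vec k (\<lambda>c. lookup (\<omega> c) S) = B *\<^sub>v v" for S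
  proof -
    have "A *\<^sub>v vec k (\<lambda>c. lookup (\<omega> c) S) = 0\<^sub>v m"
    proof (rule eq_vecI)
      fix r assume "r < dim_vec (0\<^sub>v m :: ('v, 'k) mpoly vec)"
      then show "(A *\<^sub>v vec k (\<lambda>c. lookup (\<omega> c) S)) $ r = 0\<^sub>v m $ r"
        using A zero[of r] lookup_mat_form_mult[of r A \<omega> S] by simp
    qed (use A in simp)
    then have "vec k (\<lambda>c. lookup (\<omega> c) S) \<in> mat_kernel A"
      using A by (simp add: mat_kernel_def)
    then show ?thesis
      unfolding exact by auto
  qed
  then obtain v where v: "\<And>S. v S \<in> carrier_vec l"
      "\<And>S. vec k (\<lambda>c. lookup (\<omega> c) S) = B *\<^sub>v v S"
    by metis
  define \<eta> where "\<eta> c = (\<Sum>S\<in>UNIV. Poly_Mapping.single S (v S $ c))" for c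
  have \<eta>: "lookup (\<eta> c) S = v S $ c" for c S
    by (simp add: \<eta>_def lookup_sum lookup_single when_def)
  have "\<omega> c = mat_form_mult B \<eta> c" if "c < k" for c
  proof (rule poly_mapping_eqI)
    fix S
    have "vec l (\<lambda>j. lookup (\<eta> j) S) = v S"
      using v(1)[of S] by (intro eq_vecI) (auto simp: \<eta>)
    then have "lookup (mat_form_mult B \<eta> c) S = (B *\<^sub>v v S) $ c"
      using B that by (simp add: lookup_mat_form_mult)
    also have "\<dots> = lookup (\<omega> c) S"
      using that by (simp flip: v(2))
    finally show "lookup (\<omega> c) S = lookup (mat_form_mult B \<eta> c) S" by simp
  qed
  then show ?thesis by (rule that)
qed

section \<open>The irrelevant ideal\<close>

interpretation ideal: module "(*) :: 'a::comm_ring_1 \<Rightarrow> 'a \<Rightarrow> 'a"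
  by unfold_locales (simp_all add: algebra_simps)

\<comment> \<open>As a rewrite rule this instance would reassociate all products.\<close>
declare ideal.scale_scale [simp del]

lemma irrelevant_ideal_lookup_0:
  fixes f :: "('v, 'k::comm_ring_1) mpoly"
  assumes "f \<in> irrelevant_ideal"
  shows "lookup f 0 = 0"
proof -
  obtain T c where f: "f = (\<Sum>g\<in>T. c g * g)" and "T \<subseteq> range var"
    using assms unfolding irrelevant_ideal_def ideal.span_explicit by auto
  then show ?thesis
    by (auto simp: lookup_sum mult.commute[of _ "var _"] lookup_var_mult intro!: sum.neutral)
qed

lemma ideal_sum_mult:
  "is_ideal J \<Longrightarrow> (\<And>x. x \<in> A \<Longrightarrow> g x \<in> J) \<Longrightarrow> (\<Sum>x\<in>A. g x * h x) \<in> J"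
  unfolding is_ideal_def
  by (intro ideal.subspace_sum) (auto simp: mult.commute[of "g _"] intro: ideal.subspace_scale)

lemma is_ideal_irrelevant_ideal: "is_ideal irrelevant_ideal"
  by (simp add: is_ideal_def irrelevant_ideal_def)

lemma elements_mat_subsetD:
  "elements_mat A \<subseteq> J \<Longrightarrow> r < dim_row A \<Longrightarrow> c < dim_col A \<Longrightarrow> A $$ (r, c) \<in> J"
  by (auto intro: subsetD)

lemma ideal_mult_mat_vec:
  assumes "is_ideal J" "A \<in> carrier_mat m k" "v \<in> carrier_vec k" "elements_mat A \<subseteq> J" "r < m"
  shows "(A *\<^sub>v v) $ r \<in> J"
  using assms
  by (auto simp: scalar_prod_def intro!: ideal_sum_mult elements_mat_subsetD)

lemma lookup_mat_form_mult_in_ideal: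
  fixes A :: "('v, 'k::comm_ring_1) mpoly mat"
  assumes "is_ideal J" "elements_mat A \<subseteq> J" "r < dim_row A"
  shows "lookup (mat_form_mult A \<omega> r) S \<in> J"
  using assms
  by (auto simp: mat_form_mult_def lookup_sum intro!: ideal_sum_mult elements_mat_subsetD)

section \<open>The matrices of the construction\<close>

lemma dim_nested_delta [simp]:
  "dim_row (nested_delta \<phi> i m) = dim_row (\<phi> i)"
  "dim_col (nested_delta \<phi> i m) = dim_col (\<phi> (i + m))"
  by (induction m arbitrary: i)
    (simp_all add: delta_mat_def zero_form_mat_def mult_form_mat_def)

text \<open>
  The entries of \<open>G\<^sub>i = \<delta>(\<phi>\<^sub>i \<cdot> \<delta>(\<phi>\<^bsub>i+1\<^esub> \<cdots> \<delta>(\<phi>\<^sub>p)\<cdots>))\<close>. Extending the family by the identity matrix at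
  \<open>i = p + 1\<close> makes the recursion \<open>G\<^sub>i = \<delta>(\<phi>\<^sub>i G\<^bsub>i+1\<^esub>)\<close> hold at \<open>i = p\<close> too, so the innermost matrix needs
  no separate treatment.
\<close>

definition iterated_delta ::
  "(nat \<Rightarrow> ('v::{finite,linorder}, 'k::field) mpoly mat) \<Rightarrow> nat \<Rightarrow> nat \<Rightarrow> nat \<Rightarrow> nat \<Rightarrow> ('v, 'k) form"
  where
  "iterated_delta \<phi> p i r j =
     (if i \<le> p then nested_delta \<phi> i (p - i) $$ (r, j)
      else if r = j then Poly_Mapping.single {} 1 else 0)"

lemma iterated_delta_rec:
  fixes \<phi> :: "nat \<Rightarrow> ('v::{finite,linorder}, 'k::field) mpoly mat"
  assumes "i \<le> p" "r < dim_row (\<phi> i)" "j < dim_col (\<phi> p)"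
    and "i < p \<Longrightarrow> dim_col (\<phi> i) = dim_row (\<phi> (Suc i))"
  shows "iterated_delta \<phi> p i r j
    = delta (mat_form_mult (\<phi> i) (\<lambda>l. iterated_delta \<phi> p (Suc i) l j) r)"
proof (cases "i = p")
  case True
  have "mat_form_mult (\<phi> p) (\<lambda>l. iterated_delta \<phi> p (Suc p) l j) r
      = \<phi> p $$ (r, j) \<bullet>\<^sub>f Poly_Mapping.single {} 1"
    using assms(3)
    by (simp add: mat_form_mult_def iterated_delta_def if_distrib[of "form_scale _"] cong: if_cong)
  also have "\<dots> = Poly_Mapping.single {} (\<phi> p $$ (r, j))"
    by (rule poly_mapping_eqI) (simp add: lookup_single when_def)
  finally have "mat_form_mult (\<phi> p) (\<lambda>l. iterated_delta \<phi> p (Suc p) l j) r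
      = Poly_Mapping.single {} (\<phi> p $$ (r, j))" .
  then show ?thesis
    using assms True by (simp add: iterated_delta_def delta_mat_def zero_form_mat_def)
next
  case False
  then obtain m where m: "p - i = Suc m" "p - Suc i = m" "p = Suc i + m"
    using assms(1) by (metis Suc_diff_Suc add_Suc le_add_diff_inverse le_neq_implies_less Suc_leI)
  have "dim_col (nested_delta \<phi> (Suc i) m) = dim_col (\<phi> p)"
    by (simp add: m(3))
  then show ?thesis
    using assms False m(1,2)
    by (simp add: iterated_delta_def delta_mat_def mult_form_mat_def mat_form_mult_def)
qed

text \<open>
  Downward induction on \<open>i\<close>. By \<open>contract_rad_delta\<close> it suffices that \<open>\<phi>\<^sub>i G\<^bsub>i+1\<^esub>\<close> has no constant term, which
  is minimality, and is killed by contraction. For \<open>i < p\<close> the induction hypothesis rewrites its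
  contraction as \<open>\<phi>\<^sub>i \<phi>\<^bsub>i+1\<^esub> G\<^bsub>i+2\<^esub> = 0\<close>; for \<open>i = p\<close> it is a matrix of functions.
\<close>

lemma contract_rad_iterated_delta:
  fixes \<phi> :: "nat \<Rightarrow> ('v::{finite,linorder}, 'k::field_char_0) mpoly mat"
  assumes res: "minimal_graded_free_resolution n I b a \<phi>" and "p \<le> n" and j: "j < b p"
    and "i \<le> p" "1 \<le> i" "r < b (i - 1)"
  shows "contract_rad (iterated_delta \<phi> p i r j)
    = mat_form_mult (\<phi> i) (\<lambda>l. iterated_delta \<phi> p (Suc i) l j) r"
proof -
  let ?D = "\<lambda>i r. iterated_delta \<phi> p i r j"
  have carrier: "\<phi> i \<in> carrier_mat (b (i - 1)) (b i)" if "1 \<le> i" "i \<le> n" for i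
    using res that by (auto simp: minimal_graded_free_resolution_def)
  have exact: "mat_kernel (\<phi> i) = {\<phi> (Suc i) *\<^sub>v v | v. v \<in> carrier_vec (b (Suc i))}"
    if "i < n" for i
    using res that by (auto simp: minimal_graded_free_resolution_def)
  have rad_step: "contract_rad (?D i r) = mat_form_mult (\<phi> i) (?D (Suc i)) r"
    if i: "1 \<le> i" "i \<le> p" "r < b (i - 1)"
      and rad: "contract_rad (mat_form_mult (\<phi> i) (?D (Suc i)) r) = 0" for i r
  proof -
    have "elements_mat (\<phi> i) \<subseteq> irrelevant_ideal"
      using res i \<open>p \<le> n\<close> by (auto simp: minimal_graded_free_resolution_def)
    then have "lookup (lookup (mat_form_mult (\<phi> i) (?D (Suc i)) r) {}) 0 = 0"
      using carrier[of i] i \<open>p \<le> n\<close>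
      by (intro irrelevant_ideal_lookup_0 lookup_mat_form_mult_in_ideal is_ideal_irrelevant_ideal)
        auto
    then have "contract_rad (delta (mat_form_mult (\<phi> i) (?D (Suc i)) r))
        = mat_form_mult (\<phi> i) (?D (Suc i)) r"
      using rad by (rule contract_rad_delta[rotated])
    moreover have "?D i r = delta (mat_form_mult (\<phi> i) (?D (Suc i)) r)"
      using i carrier[of i] carrier[of p] carrier[of "Suc i"] \<open>p \<le> n\<close> j
      by (intro iterated_delta_rec) auto
    ultimately show ?thesis by simp
  qed
  show ?thesis
    using assms(4-6)
  proof (induction i arbitrary: r rule: inc_induct)
    case base
    have "contract_rad (?D (Suc p) l) = 0" for l
      by (rule poly_mapping_eqI)
        (auto simp: iterated_delta_def lookup_contract_rad lookup_single)
    then show ?case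
      using base by (intro rad_step) (auto simp: mat_form_mult_def contract_rad.sum contract_rad.scale)
  next
    case (step i)
    have "contract_rad (mat_form_mult (\<phi> i) (?D (Suc i)) r)
        = mat_form_mult (\<phi> i) (\<lambda>l. contract_rad (?D (Suc i) l)) r"
      by (rule contract_rad_mat_form_mult)
    also have "\<dots> = mat_form_mult (\<phi> i) (mat_form_mult (\<phi> (Suc i)) (?D (Suc (Suc i)))) r"
      using step.IH carrier[of i] step \<open>p \<le> n\<close> by (intro mat_form_mult_cong) auto
    also have "\<dots> = 0"
      using carrier[of i] carrier[of "Suc i"] step \<open>p \<le> n\<close>
      by (intro mat_form_mult_complex[OF _ _ exact]) auto
    finally show ?case
      using step by (intro rad_step) auto
  qed
qed

lemma nested_delta_in_forms:
  fixes \<phi> :: "nat \<Rightarrow> ('v::{finite,linorder}, 'k::field) mpoly mat"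
  assumes "\<And>l. i \<le> l \<Longrightarrow> l < i + m \<Longrightarrow> dim_col (\<phi> l) = dim_row (\<phi> (Suc l))"
    and "r < dim_row (\<phi> i)" "j < dim_col (\<phi> (i + m))"
  shows "nested_delta \<phi> i m $$ (r, j) \<in> forms (Suc m)"
  using assms
proof (induction m arbitrary: i r)
  case 0
  have "Poly_Mapping.single {} f \<in> forms 0" for f :: "('v, 'k) mpoly"
    by (auto simp: forms_def in_keys_iff lookup_single when_def split: if_splits)
  with 0 show ?case
    by (auto simp: delta_mat_def zero_form_mat_def intro: delta_in_forms)
next
  case (Suc m)
  have "nested_delta \<phi> (Suc i) m $$ (l, j) \<in> forms (Suc m)" if "l < dim_col (\<phi> i)" for l
    using that Suc.prems by (intro Suc.IH) auto
  then show ?case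
    using Suc.prems
    by (auto simp: delta_mat_def mult_form_mat_def intro!: delta_in_forms forms_sum forms_scale)
qed

lemma xi_conv_mat_form_mult:
  fixes \<phi> :: "nat \<Rightarrow> ('v::{finite,linorder}, 'k::field) mpoly mat"
  assumes "1 \<le> p" "dim_row (\<phi> 0) = 1"
  shows "xi \<phi> p t = mat_form_mult (\<phi> 0)
    (\<lambda>l. \<Sum>j<dim_col (\<phi> p). const_poly (t $ j) \<bullet>\<^sub>f iterated_delta \<phi> p 1 l j) 0"
  using assms
  by (simp add: xi_def mult_form_mat_vec_def mult_form_mat_def mat_form_mult_sum_scale
      iterated_delta_def mat_form_mult_def)

text \<open>
  The climb through the resolution: the relation \<open>\<phi>\<^sub>i (G\<^bsub>i+1\<^esub> t - \<iota>\<^bsub>rad\<^esub> H) = 0\<close> is moved from \<open>i = 0\<close>, where it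
  expresses the hypothesis, to \<open>i = p\<close>, where \<open>G\<^bsub>p+1\<^esub> t = t\<close> and minimality applies.
\<close>

lemma xi_radial_imp_zero:
  fixes \<phi> :: "nat \<Rightarrow> ('v::{finite,linorder}, 'k::field_char_0) mpoly mat"
  assumes res: "minimal_graded_free_resolution n I b a \<phi>" and p: "1 \<le> p" "p \<le> n"
    and t: "t \<in> carrier_vec (b p)"
    and radial: "xi \<phi> p t \<in> radial_submodule p I"
  shows "t = 0\<^sub>v (b p)"
proof -
  have carrier0: "\<phi> 0 \<in> carrier_mat 1 (b 0)"
    and image0: "{(\<phi> 0 *\<^sub>v v) $ 0 | v. v \<in> carrier_vec (b 0)} = I"
    and kernel_last: "mat_kernel (\<phi> n) = {0\<^sub>v (b n)}"
    using res by (auto simp: minimal_graded_free_resolution_def)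
  have carrier: "\<phi> i \<in> carrier_mat (b (i - 1)) (b i)" if "1 \<le> i" "i \<le> n" for i
    using res that by (auto simp: minimal_graded_free_resolution_def)
  have carrier': "\<phi> i \<in> carrier_mat (if i = 0 then 1 else b (i - 1)) (b i)" if "i \<le> n" for i
    using carrier0 carrier[of i] that by auto
  have exact: "mat_kernel (\<phi> i) = {\<phi> (Suc i) *\<^sub>v v | v. v \<in> carrier_vec (b (Suc i))}"
    if "i < n" for i
    using res that by (auto simp: minimal_graded_free_resolution_def)
  have irrelevant: "elements_mat (\<phi> i) \<subseteq> irrelevant_ideal" if "1 \<le> i" "i \<le> n" for i
    using res that by (auto simp: minimal_graded_free_resolution_def)
  \<comment> \<open>The column \<open>G\<^sub>i t\<close>.\<close>
  define y where "y i r = (\<Sum>j<b p. const_poly (t $ j) \<bullet>\<^sub>f iterated_delta \<phi> p i r j)" for i r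
  have rad_y: "contract_rad (y i r) = mat_form_mult (\<phi> i) (y (Suc i)) r"
    if "1 \<le> i" "i \<le> p" "r < b (i - 1)" for i r
    unfolding y_def mat_form_mult_sum_scale contract_rad.sum contract_rad.scale
    using that p by (intro sum.cong) (auto simp: contract_rad_iterated_delta[OF res])
  have xi: "xi \<phi> p t = mat_form_mult (\<phi> 0) (y 1) 0"
    using carrier[of p] carrier0 p by (simp add: xi_conv_mat_form_mult y_def[abs_def])
  \<comment> \<open>The bound on \<open>r\<close> is the number of rows of \<open>\<phi> i\<close>.\<close>
  have lift: "\<exists>\<eta>. \<forall>r < (if i = 0 then 1 else b (i - 1)).
      mat_form_mult (\<phi> i) (\<lambda>l. y (Suc i) l - contract_rad (\<eta> l)) r = 0" if "i \<le> p" for i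
    using that
  proof (induction i)
    case 0
    obtain N F \<theta> where F: "\<And>i. i < N \<Longrightarrow> F i \<in> I"
      and sum: "xi \<phi> p t = (\<Sum>i<(N::nat). F i \<bullet>\<^sub>f contract_rad (\<theta> i))"
      using radial by (auto simp: radial_submodule_def)
    have "\<forall>i<N. \<exists>v\<in>carrier_vec (b 0). F i = (\<phi> 0 *\<^sub>v v) $ 0"
      using F image0 by auto
    then obtain v where v: "\<And>i. i < N \<Longrightarrow> v i \<in> carrier_vec (b 0)"
        "\<And>i. i < N \<Longrightarrow> F i = (\<phi> 0 *\<^sub>v v i) $ 0"
      by metis
    define \<eta> where "\<eta> l = (\<Sum>i<N. v i $ l \<bullet>\<^sub>f \<theta> i)" for l
    have F_eq: "F i \<bullet>\<^sub>f contract_rad (\<theta> i)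
        = mat_form_mult (\<phi> 0) (\<lambda>l. v i $ l \<bullet>\<^sub>f contract_rad (\<theta> i)) 0" if "i < N" for i
      using v[OF that] carrier0
      by (simp add: mat_form_mult_def scalar_prod_def form.scale_sum_left lessThan_atLeast0)
    have "mat_form_mult (\<phi> 0) (\<lambda>l. contract_rad (\<eta> l)) 0
        = (\<Sum>i<N. mat_form_mult (\<phi> 0) (\<lambda>l. v i $ l \<bullet>\<^sub>f contract_rad (\<theta> i)) 0)"
      unfolding \<eta>_def contract_rad.sum contract_rad.scale mat_form_mult_def form.scale_sum_right
      by (rule sum.swap)
    also have "\<dots> = xi \<phi> p t"
      by (simp add: sum F_eq)
    finally show ?case
      using xi by (intro exI[of _ \<eta>]) (simp add: mat_form_mult_diff)
  next
    case (Suc i)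
    then obtain \<eta> where \<eta>: "mat_form_mult (\<phi> i) (\<lambda>l. y (Suc i) l - contract_rad (\<eta> l)) r = 0"
      if "r < (if i = 0 then 1 else b (i - 1))" for r
      by auto
    have "i < n" using Suc.prems p by simp
    obtain \<theta> where \<theta>: "\<And>c. c < b i \<Longrightarrow>
        y (Suc i) c - contract_rad (\<eta> c) = mat_form_mult (\<phi> (Suc i)) \<theta> c"
      using mat_form_mult_exact[OF carrier'[of i] _ exact[OF \<open>i < n\<close>] \<eta>] carrier[of "Suc i"] \<open>i < n\<close>
      by auto
    have "mat_form_mult (\<phi> (Suc i)) (\<lambda>l. y (Suc (Suc i)) l - contract_rad (\<theta> l)) r = 0"
      if "r < b i" for r
    proof -
      \<comment> \<open>Contracting the equation \<open>\<theta>\<close>: the term with \<open>\<eta>\<close> disappears since contraction squares to zero.\<close>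
      have "mat_form_mult (\<phi> (Suc i)) (y (Suc (Suc i))) r = contract_rad (y (Suc i) r)"
        using that Suc.prems by (simp add: rad_y)
      also have "\<dots> = contract_rad (y (Suc i) r - contract_rad (\<eta> r))"
        by (simp add: contract_rad.diff contract_rad_contract_rad)
      also have "\<dots> = mat_form_mult (\<phi> (Suc i)) (\<lambda>l. contract_rad (\<theta> l)) r"
        by (simp add: \<theta>[OF that] contract_rad_mat_form_mult)
      finally show ?thesis
        by (simp add: mat_form_mult_diff)
    qed
    then show ?case by auto
  qed
  obtain \<eta> where \<eta>:
    "\<And>r. r < b (p - 1) \<Longrightarrow> mat_form_mult (\<phi> p) (\<lambda>l. y (Suc p) l - contract_rad (\<eta> l)) r = 0"
    using lift[of p] p by auto
  \<comment> \<open>The coefficients at \<open>{}\<close>, that is, the \<open>0\<close>-form part of \<open>t - \<iota>\<^bsub>rad\<^esub> \<eta>\<close>.\<close>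
  define u where "u = vec (b p) (\<lambda>l. lookup (y (Suc p) l - contract_rad (\<eta> l)) {})"
  have "\<phi> p *\<^sub>v u = 0\<^sub>v (b (p - 1))"
  proof (rule eq_vecI)
    fix r assume r: "r < dim_vec (0\<^sub>v (b (p - 1)) :: ('v, 'k) mpoly vec)"
    then show "(\<phi> p *\<^sub>v u) $ r = 0\<^sub>v (b (p - 1)) $ r"
      using lookup_mat_form_mult[of r "\<phi> p" "\<lambda>l. y (Suc p) l - contract_rad (\<eta> l)" "{}"]
        carrier[OF p] \<eta>[of r]
      by (simp add: u_def)
  qed (use carrier[OF p] in simp)
  then have u: "u \<in> mat_kernel (\<phi> p)"
    using carrier[OF p] by (simp add: mat_kernel_def u_def)
  have u_irrelevant: "u $ j \<in> irrelevant_ideal" if "j < b p" for j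
  proof (cases "p = n")
    case True
    then show ?thesis
      using u kernel_last that is_ideal_irrelevant_ideal ideal.subspace_0
      by (auto simp: is_ideal_def)
  next
    case False
    then have "p < n" using p by simp
    then show ?thesis
      using u exact[OF \<open>p < n\<close>] that carrier[of "Suc p"] irrelevant[of "Suc p"]
      by (auto intro!: ideal_mult_mat_vec is_ideal_irrelevant_ideal)
  qed
  show ?thesis
  proof (rule eq_vecI)
    fix j assume "j < dim_vec (0\<^sub>v (b p) :: 'k vec)"
    then have j: "j < b p" by simp
    have "y (Suc p) j = const_poly (t $ j) \<bullet>\<^sub>f Poly_Mapping.single {} 1"
      using j by (simp add: y_def iterated_delta_def if_distrib[of "form_scale _"] sum.delta
          cong: if_cong)
    then have "lookup (lookup (y (Suc p) j) {}) 0 = t $ j"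
      by (simp add: lookup_single const_poly_def)
    moreover have "lookup (lookup (contract_rad (\<eta> j)) {}) 0 = 0"
      by (simp add: lookup_contract_rad lookup_sum wedge_sign_conv_const_poly
          lookup_const_poly_mult lookup_var_mult)
    moreover have "lookup (u $ j) 0 = 0"
      using u_irrelevant[OF j] by (rule irrelevant_ideal_lookup_0)
    ultimately show "t $ j = 0\<^sub>v (b p) $ j"
      using j by (simp add: u_def lookup_minus)
  qed (use t in simp)
qed

theorem proposition3p2:
  fixes n p :: nat
    and I :: "('v::{finite,linorder}, 'k::{alg_closed_field,field_char_0}) mpoly set"
    and b :: "nat \<Rightarrow> nat"
    and a :: "nat \<Rightarrow> nat \<Rightarrow> int"
    and \<phi> :: "nat \<Rightarrow> ('v, 'k) mpoly mat"
  assumes "CARD('v) = n + 1"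
    and "1 \<le> p" and "p \<le> n"
    and "saturated_homogeneous_ideal I"
    and "minimal_graded_free_resolution n I b a \<phi>"
  shows "xi \<phi> p ` carrier_vec (b p) \<subseteq> twisted_forms p I
    \<and> (\<forall>s\<in>carrier_vec (b p). \<forall>t\<in>carrier_vec (b p). xi \<phi> p (s + t) = xi \<phi> p s + xi \<phi> p t)
    \<and> (\<forall>c. \<forall>t\<in>carrier_vec (b p). xi \<phi> p (c \<cdot>\<^sub>v t) = const_poly c \<bullet>\<^sub>f xi \<phi> p t)
    \<and> inj_on (xi \<phi> p) (carrier_vec (b p))
    \<and> radial_submodule p I \<subseteq> twisted_forms p I
    \<and> xi \<phi> p ` carrier_vec (b p) \<inter> radial_submodule p I = {0}"
proof -
  note p = \<open>1 \<le> p\<close> \<open>p \<le> n\<close> and res = assms(5)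
  have hom: "homogeneous_ideal I" and ideal: "is_ideal I"
    using assms(4) by (auto simp: saturated_homogeneous_ideal_def homogeneous_ideal_def)
  have carrier0: "\<phi> 0 \<in> carrier_mat 1 (b 0)"
    and image0: "{(\<phi> 0 *\<^sub>v v) $ 0 | v. v \<in> carrier_vec (b 0)} = I"
    using res by (auto simp: minimal_graded_free_resolution_def)
  have carrier: "\<phi> i \<in> carrier_mat (b (i - 1)) (b i)" if "1 \<le> i" "i \<le> n" for i
    using res that by (auto simp: minimal_graded_free_resolution_def)
  have exact0: "mat_kernel (\<phi> 0) = {\<phi> 1 *\<^sub>v v | v. v \<in> carrier_vec (b 1)}"
    using res p by (auto simp: minimal_graded_free_resolution_def)
  have dims: "dim_row (\<phi> 0) = 1" "dim_col (\<phi> p) = b p"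
    using carrier0 carrier[OF p] by auto
  have generators: "\<phi> 0 $$ (0, l) \<in> I" if "l < b 0" for l
  proof -
    have "(\<phi> 0 *\<^sub>v unit_vec (b 0) l) $ 0 = \<phi> 0 $$ (0, l)"
      using carrier0 that by simp
    then show ?thesis
      using image0 unit_vec_carrier[of "b 0" l] by (metis (mono_tags, lifting) mem_Collect_eq)
  qed
  have xi: "xi \<phi> p t = (\<Sum>j<b p. const_poly (t $ j) \<bullet>\<^sub>f
      mat_form_mult (\<phi> 0) (\<lambda>l. iterated_delta \<phi> p 1 l j) 0)" for t
    using p by (simp add: xi_conv_mat_form_mult dims mat_form_mult_sum_scale)
  have add: "xi \<phi> p (s + t) = xi \<phi> p s + xi \<phi> p t"
    if "s \<in> carrier_vec (b p)" "t \<in> carrier_vec (b p)" for s t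
    using that
    by (simp add: xi const_poly_def single_add form.scale_left_distrib flip: sum.distrib)
  have scale: "xi \<phi> p (c \<cdot>\<^sub>v t) = const_poly c \<bullet>\<^sub>f xi \<phi> p t" if "t \<in> carrier_vec (b p)" for c t
    using that
    by (simp add: xi const_poly_def mult_single form.scale_sum_right)
  have "xi \<phi> p t \<in> twisted_forms p I" if "t \<in> carrier_vec (b p)" for t
  proof (rule twisted_formsI[OF hom p(1)])
    have "iterated_delta \<phi> p 1 l j \<in> forms p" if "l < b 0" "j < b p" for l j
    proof -
      have "nested_delta \<phi> 1 (p - 1) $$ (l, j) \<in> forms (Suc (p - 1))"
      proof (rule nested_delta_in_forms)
        fix i assume "1 \<le> i" "i < 1 + (p - 1)"
        then show "dim_col (\<phi> i) = dim_row (\<phi> (Suc i))"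
          using p carrier[of i] carrier[of "Suc i"] by auto
      qed (use that p carrier[of 1] dims in auto)
      then show ?thesis using p by (simp add: iterated_delta_def)
    qed
    then show "xi \<phi> p t \<in> forms p"
      using carrier0 by (auto simp: xi mat_form_mult_def intro!: forms_sum forms_scale)
    have "contract_rad (mat_form_mult (\<phi> 0) (\<lambda>l. iterated_delta \<phi> p 1 l j) 0)
        = mat_form_mult (\<phi> 0) (mat_form_mult (\<phi> 1) (\<lambda>l. iterated_delta \<phi> p (Suc 1) l j)) 0"
      if "j < b p" for j
      unfolding contract_rad_mat_form_mult
      using that p carrier0
      by (intro mat_form_mult_cong contract_rad_iterated_delta[OF res]) auto
    moreover have "mat_form_mult (\<phi> 0) (mat_form_mult (\<phi> 1) \<omega>) 0 = 0" for \<omega>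
      using p carrier[of 1] by (intro mat_form_mult_complex[OF carrier0 _ exact0]) auto
    ultimately show "contract_rad (xi \<phi> p t) = 0"
      by (simp add: xi contract_rad.sum contract_rad.scale)
    have "elements_mat (\<phi> 0) \<subseteq> I"
      using generators carrier0 by (auto simp: elements_mat_def)
    then show "lookup (xi \<phi> p t) S \<in> I" for S
      using p dims ideal by (simp add: xi_conv_mat_form_mult lookup_mat_form_mult_in_ideal)
  qed
  moreover have "inj_on (xi \<phi> p) (carrier_vec (b p))"
  proof (rule inj_onI)
    fix s t assume s: "s \<in> carrier_vec (b p)" and t: "t \<in> carrier_vec (b p)"
      and eq: "xi \<phi> p s = xi \<phi> p t"
    have "xi \<phi> p (s + (- 1) \<cdot>\<^sub>v t) = xi \<phi> p s + const_poly (- 1) \<bullet>\<^sub>f xi \<phi> p t"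
      using s t by (simp add: add scale)
    also have "\<dots> = 0"
      by (simp add: eq const_poly_def single_uminus)
    finally have "xi \<phi> p (s + (- 1) \<cdot>\<^sub>v t) \<in> radial_submodule p I"
      by (auto simp: radial_submodule_def intro!: exI[of _ "0::nat"])
    then have "s + (- 1) \<cdot>\<^sub>v t = 0\<^sub>v (b p)"
      using s t by (intro xi_radial_imp_zero[OF res p]) auto
    then show "s = t"
      using s t by (auto simp: vec_eq_iff)
  qed
  moreover have "radial_submodule p I \<subseteq> twisted_forms p I"
  proof
    fix \<omega> assume "\<omega> \<in> radial_submodule p I"
    then obtain N F \<eta> where \<omega>: "\<omega> = (\<Sum>i<(N::nat). F i \<bullet>\<^sub>f contract_rad (\<eta> i))"
      and F: "\<And>i. i < N \<Longrightarrow> F i \<in> I" and \<eta>: "\<And>i. i < N \<Longrightarrow> \<eta> i \<in> forms (p + 1)"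
      by (auto simp: radial_submodule_def)
    show "\<omega> \<in> twisted_forms p I"
    proof (rule twisted_formsI[OF hom p(1)])
      show "\<omega> \<in> forms p"
        unfolding \<omega> using \<eta> by (auto intro!: forms_sum forms_scale contract_rad_in_forms)
      show "contract_rad \<omega> = 0"
        by (simp add: \<omega> contract_rad.sum contract_rad.scale contract_rad_contract_rad)
      show "lookup \<omega> S \<in> I" for S
        using F by (auto simp: \<omega> lookup_sum intro: ideal_sum_mult[OF ideal])
    qed
  qed
  moreover have "xi \<phi> p ` carrier_vec (b p) \<inter> radial_submodule p I = {0}"
  proof -
    have "xi \<phi> p (0\<^sub>v (b p)) = 0"
      by (simp add: xi const_poly_def)
    moreover have "0 \<in> radial_submodule p I"
      by (auto simp: radial_submodule_def intro!: exI[of _ "0::nat"])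
    moreover have "0 \<in> xi \<phi> p ` carrier_vec (b p)"
      using \<open>xi \<phi> p (0\<^sub>v (b p)) = 0\<close> by (metis imageI zero_carrier_vec)
    ultimately show ?thesis
      using xi_radial_imp_zero[OF res p] by auto
  qed
  ultimately show ?thesis
    using add scale by blast
qed

end
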